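(* Let $n\ge1$ be an integer, $q$ a prime power, and $\{e_1,\dots,e_n\}$ a linear basis of $\mathbb{F}_q^n$. Let $$A:=\{\varepsilon_1e_1+\dots+\varepsilon_ne_n:\varepsilon_1,\dots,\varepsilon_n\in\mathbb{F}_q^\times\},\qquad B:=\{\varepsilon_1e_1+\dots+\varepsilon_ne_n:\varepsilon_1,\dots,\varepsilon_n\in\{0,1\}\}.$$ Then $K:=A\cup B$ is a rank-$1$ Kakeya set in $\mathbb{F}_q^n$ and $|K|=(q-1)^n+2^n-1$.
   Context: $\mathbb{F}_q$ denotes the finite field with $q$ elements and $\mathbb{F}_q^\times$ its set of non-zero elements. A subset $K\subseteq\mathbb{F}_q^n$ is a rank-$1$ Kakeya set if for every one-dimensional subspace $L\le\mathbb{F}_q^n$ there exists $v\in\mathbb{F}_q^n$ with $v+L\subseteq K$. *)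

theory Defs
  imports "HOL-Analysis.Cartesian_Space"
begin

definition rank1_kakeya :: "('a::{field,finite} ^ 'n) set \<Rightarrow> bool" where
  "rank1_kakeya K \<longleftrightarrow>
     (\<forall>L. vec.subspace L \<and> vec.dim L = 1 \<longrightarrow> (\<exists>v. (\<lambda>x. v + x) ` L \<subseteq> K))"

end

theory Submission
  imports Defs
begin

text \<open>
  In coordinates with respect to the basis, let a line have direction \<open>x = (c\<^sub>1, \<dots>, c\<^sub>n)\<close>, and let
  \<open>v\<close> be the 0/1 vector supported on the zeros of \<open>c\<close>. Then \<open>v\<close> lies in \<open>B\<close>, while for \<open>t \<noteq> 0\<close>
  every coordinate of \<open>v + t x\<close> is either \<open>1\<close> or \<open>t c\<^sub>i \<noteq> 0\<close>, so \<open>v + t x\<close> lies in \<open>A\<close>.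
  For the cardinality, \<open>A\<close> and \<open>B\<close> share only the vector with all coordinates \<open>1\<close>.
\<close>

lemma inj_linear_combination:
  fixes e :: "'n::finite \<Rightarrow> 'a::field ^ 'm"
  assumes "inj e" and "vec.independent (range e)"
  shows "inj (\<lambda>\<epsilon>. \<Sum>i\<in>UNIV. \<epsilon> i *s e i)"
proof (rule injI, rule ext)
  fix f g and i :: 'n
  assume eq: "(\<Sum>i\<in>UNIV. f i *s e i) = (\<Sum>i\<in>UNIV. g i *s e i)"
  \<comment> \<open>Independence concerns coefficients attached to vectors, so the difference of
    \<open>f\<close> and \<open>g\<close> is carried from indices to \<open>range e\<close> along
    \<open>inv e\<close>.\<close>
  define u where "u v = f (inv e v) - g (inv e v)" for v
  have "(\<Sum>v\<in>range e. u v *s v) = (\<Sum>i\<in>UNIV. (f i - g i) *s e i)"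
    using assms(1) by (simp add: sum.reindex u_def)
  also have "\<dots> = 0"
    using eq by (simp add: vec.scale_left_diff_distrib sum_subtractf)
  finally have "u (e i) = 0"
    by (intro vec.independentD[OF assms(2), of "range e"]) auto
  then show "f i = g i"
    using assms(1) by (simp add: u_def)
qed

lemma surj_linear_combination:
  fixes e :: "'n::finite \<Rightarrow> 'a::field ^ 'm"
  assumes "inj e" and "vec.span (range e) = UNIV"
  shows "surj (\<lambda>\<epsilon>. \<Sum>i\<in>UNIV. \<epsilon> i *s e i)"
proof -
  have "x \<in> range (\<lambda>\<epsilon>. \<Sum>i\<in>UNIV. \<epsilon> i *s e i)" for x
  proof -
    obtain u where "x = (\<Sum>v\<in>range e. u v *s v)"
      using assms(2) vec.span_finite[of "range e"] by auto
    then have "x = (\<Sum>i\<in>UNIV. (u \<circ> e) i *s e i)"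
      using assms(1) by (simp add: sum.reindex)
    then show ?thesis
      by blast
  qed
  then show ?thesis
    by blast
qed

text \<open>Over the full index type extensionality is no constraint, so these functions form a
  \<open>PiE\<close> set.\<close>

lemma card_functions_into:
  "card {f :: 'n::finite \<Rightarrow> 'a. \<forall>i. f i \<in> S} = card S ^ CARD('n)"
  using card_PiE[of "UNIV :: 'n set" "\<lambda>_. S"] by (simp add: PiE_def Pi_def)

theorem theorem4:
  fixes e :: "'n::finite \<Rightarrow> 'a::{field,finite} ^ 'n"
    and A B K :: "('a ^ 'n) set"
  assumes "inj e"
    and "vec.independent (range e)"
    and "vec.span (range e) = UNIV"
  defines "A \<equiv> {(\<Sum>i\<in>UNIV. \<epsilon> i *s e i) | \<epsilon>. \<forall>i. \<epsilon> i \<in> UNIV - {0}}"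
    and "B \<equiv> {(\<Sum>i\<in>UNIV. \<epsilon> i *s e i) | \<epsilon>. \<forall>i. \<epsilon> i \<in> {0, 1}}"
    and "K \<equiv> A \<union> B"
  shows "rank1_kakeya K \<and> card K = (CARD('a) - 1) ^ CARD('n) + 2 ^ CARD('n) - 1"
proof
  define \<phi> where "\<phi> \<epsilon> = (\<Sum>i\<in>UNIV. \<epsilon> i *s e i)" for \<epsilon> :: "'n \<Rightarrow> 'a"
  let ?FA = "{\<epsilon> :: 'n \<Rightarrow> 'a. \<forall>i. \<epsilon> i \<in> UNIV - {0}}"
  let ?FB = "{\<epsilon> :: 'n \<Rightarrow> 'a. \<forall>i. \<epsilon> i \<in> {0, 1}}"
  have A: "A = \<phi> ` ?FA" and B: "B = \<phi> ` ?FB"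
    unfolding A_def B_def \<phi>_def by blast+
  have inj: "inj \<phi>" and surj: "surj \<phi>"
    unfolding \<phi>_def using assms(1-3)
    by (simp_all add: inj_linear_combination surj_linear_combination)
  show "rank1_kakeya K"
    unfolding rank1_kakeya_def
  proof (intro allI impI)
    fix L :: "('a ^ 'n) set"
    assume "vec.subspace L \<and> vec.dim L = 1"
    \<comment> \<open>A one-element basis of \<open>L\<close> makes each of its points a multiple of
      a single vector \<open>x\<close>, the direction of the line.\<close>
    then obtain S where "L \<subseteq> vec.span S" and "card S = 1"
      using vec.basis_exists[of L] by metis
    then obtain x where L: "L \<subseteq> vec.span {x}"
      using card_1_singletonE by metis
    obtain c where c: "x = \<phi> c"
      using surj by auto
    define d where "d i = (if c i = 0 then 1 else 0 :: 'a)" for i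
    have "\<phi> d + y \<in> K" if y: "y \<in> L" for y
    proof -
      obtain t where t: "y = t *s x"
        using L y unfolding vec.span_singleton by blast
      have "\<phi> d + y = \<phi> (\<lambda>i. d i + t * c i)"
        by (simp add: t c \<phi>_def vec.scale_sum_right vec.scale_left_distrib sum.distrib)
      moreover have "(\<lambda>i. d i + t * c i) \<in> ?FA \<union> ?FB"
        by (cases "t = 0") (auto simp: d_def)
      ultimately show ?thesis
        unfolding K_def A B by blast
    qed
    then show "\<exists>v. (\<lambda>x. v + x) ` L \<subseteq> K"
      by blast
  qed
  have "?FA \<inter> ?FB = {\<lambda>_. 1}"
    by (auto intro!: ext)
  then have "card (?FA \<inter> ?FB) = 1"
    by simp
  \<comment> \<open>Additive inclusion-exclusion: subtracting the overlap is left to the last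
    step.\<close>
  moreover have "card (?FA \<union> ?FB) + card (?FA \<inter> ?FB) = card ?FA + card ?FB"
    by (intro card_Un_Int[symmetric]) simp_all
  moreover have "card ?FA = (CARD('a) - 1) ^ CARD('n)" and "card ?FB = 2 ^ CARD('n)"
    unfolding card_functions_into by (simp_all add: card_Diff_singleton numeral_2_eq_2)
  \<comment> \<open>Since \<open>\<phi>\<close> is injective, counting vectors of \<open>K\<close>
    reduces to counting coefficient functions.\<close>
  moreover have "card K = card (?FA \<union> ?FB)"
    unfolding K_def A B image_Un[symmetric]
    by (intro card_image inj_on_subset[OF inj]) simp
  ultimately show "card K = (CARD('a) - 1) ^ CARD('n) + 2 ^ CARD('n) - 1"
    by linarith
qed

end
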